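(* The SONC cone coincides with the SAGE cone; that is, a polynomial in $\mathbb{R}[x_1,\ldots,x_n]$ is a sum of nonnegative circuit polynomials if and only if it is a sum of AGE polynomials.
   Context: Here $\mathbb{N}$ contains $0$, and $\mathbf{x}^{\boldsymbol{\alpha}}=x_1^{\alpha_1}\cdots x_n^{\alpha_n}$. A trellis is a finite set $\mathscr{A}\subseteq(2\mathbb{N})^n$ comprising the vertices of a simplex (of any dimension). A circuit polynomial is a polynomial of the form $\sum_{\boldsymbol{\alpha}\in\mathscr{A}}c_{\boldsymbol{\alpha}}\mathbf{x}^{\boldsymbol{\alpha}}-d\mathbf{x}^{\boldsymbol{\beta}}$ where $\mathscr{A}$ is a trellis, $c_{\boldsymbol{\alpha}}>0$ for all $\boldsymbol{\alpha}\in\mathscr{A}$, $d\in\mathbb{R}$, and $\boldsymbol{\beta}\in\mathbb{N}^n$ lies in the relative interior of the convex hull of $\mathscr{A}$. A nonnegative circuit polynomial is a circuit polynomial that is nonnegative on $\mathbb{R}^n$; by convention a monomial square $c\mathbf{x}^{\boldsymbol{\alpha}}$ with $c>0$, $\boldsymbol{\alpha}\in(2\mathbb{N})^n$ is also regarded as one. The SONC cone is the convex cone of all (finite, possibly empty) sums of nonnegative circuit polynomials. An AGE polynomial is a polynomial that is nonnegative on $\mathbb{R}^n$ and of the form $\sum_{i=1}^m c_i\mathbf{x}^{\boldsymbol{\alpha}_i}-d\mathbf{x}^{\boldsymbol{\beta}}$ with $\boldsymbol{\alpha}_i\in(2\mathbb{N})^n$, $c_i>0$, $i=1,\ldots,m$,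 and either $\boldsymbol{\beta}\in\mathbb{N}^n\setminus(2\mathbb{N})^n$ (with $d\in\mathbb{R}$), or $\boldsymbol{\beta}\in(2\mathbb{N})^n$ and $d\ge 0$. The SAGE cone is the convex cone of all (finite, possibly empty) sums of AGE polynomials. *)

theory Defs
  imports "HOL-Analysis.Analysis" "HOL-Library.Poly_Mapping"
begin

type_synonym 'n exponent = "nat ^ 'n"

text \<open>
  The polynomial ring in the variables indexed by the finite type \<open>'n\<close>, so the number of
  variables is \<open>CARD('n)\<close>. A polynomial is its finitely supported coefficient function on
  exponent vectors; \<^const>\<open>Poly_Mapping.single\<close> builds the terms.
\<close>
type_synonym 'n mpolynomial = "'n exponent \<Rightarrow>\<^sub>0 real"

definition eval_monom :: "'n::finite exponent \<Rightarrow> real ^ 'n \<Rightarrow> real" where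
  "eval_monom \<alpha> x = (\<Prod>i\<in>UNIV. (x $ i) ^ (\<alpha> $ i))"

definition eval_poly :: "'n::finite mpolynomial \<Rightarrow> real ^ 'n \<Rightarrow> real" where
  "eval_poly p x = (\<Sum>\<alpha>\<in>Poly_Mapping.keys p. Poly_Mapping.lookup p \<alpha> * eval_monom \<alpha> x)"

definition nonneg_poly :: "'n::finite mpolynomial \<Rightarrow> bool" where
  "nonneg_poly p \<longleftrightarrow> (\<forall>x. eval_poly p x \<ge> 0)"

definition even_exponents :: "'n::finite exponent set" where
  "even_exponents = {\<alpha>. \<forall>i. even (\<alpha> $ i)}"

definition real_exponent :: "'n::finite exponent \<Rightarrow> real ^ 'n" where
  "real_exponent \<alpha> = (\<chi> i. real (\<alpha> $ i))"

text \<open>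
  The library regards the empty set as a simplex of dimension \<open>-1\<close>; the condition \<open>k \<ge> 0\<close>
  excludes it. The dimension 0, where the trellis is a single point, is allowed.
\<close>
definition trellis :: "'n::finite exponent set \<Rightarrow> bool" where
  "trellis A \<longleftrightarrow> finite A \<and> A \<subseteq> even_exponents \<and>
     (\<exists>k S. k \<ge> 0 \<and> k simplex S \<and> real_exponent ` A = {v. v extreme_point_of S})"

definition circuit_poly :: "'n::finite mpolynomial \<Rightarrow> bool" where
  "circuit_poly p \<longleftrightarrow>
     (\<exists>A c d \<beta>. trellis A \<and> (\<forall>\<alpha>\<in>A. c \<alpha> > 0) \<and>
        real_exponent \<beta> \<in> rel_interior (convex hull (real_exponent ` A)) \<and>
        p = (\<Sum>\<alpha>\<in>A. Poly_Mapping.single \<alpha> (c \<alpha>)) - Poly_Mapping.single \<beta> d)"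

definition monomial_square :: "'n::finite mpolynomial \<Rightarrow> bool" where
  "monomial_square p \<longleftrightarrow>
     (\<exists>c \<alpha>. c > 0 \<and> \<alpha> \<in> even_exponents \<and> p = Poly_Mapping.single \<alpha> c)"

definition nonneg_circuit_poly :: "'n::finite mpolynomial \<Rightarrow> bool" where
  "nonneg_circuit_poly p \<longleftrightarrow> (circuit_poly p \<and> nonneg_poly p) \<or> monomial_square p"

definition AGE_poly :: "'n::finite mpolynomial \<Rightarrow> bool" where
  "AGE_poly p \<longleftrightarrow> nonneg_poly p \<and>
     (\<exists>(m::nat) c \<alpha> d \<beta>. (\<forall>i\<in>{1..m}. \<alpha> i \<in> even_exponents \<and> c i > 0) \<and>
        (\<beta> \<notin> even_exponents \<or> (\<beta> \<in> even_exponents \<and> d \<ge> 0)) \<and>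
        p = (\<Sum>i=1..m. Poly_Mapping.single (\<alpha> i) (c i)) - Poly_Mapping.single \<beta> d)"

text \<open>The empty list contributes the empty sum, that is, the zero polynomial.\<close>

definition SONC :: "'n::finite mpolynomial set" where
  "SONC = {sum_list ps | ps. \<forall>p\<in>set ps. nonneg_circuit_poly p}"

definition SAGE :: "'n::finite mpolynomial set" where
  "SAGE = {sum_list ps | ps. \<forall>p\<in>set ps. AGE_poly p}"

end

theory Submission imports Defs begin

text \<open>
  A nonnegative circuit polynomial is AGE, unless its inner term has an even exponent and a
  positive coefficient, in which case it is a sum of monomial squares. The content is the
  converse: every AGE polynomial \<open>\<Sum>\<^sub>\<alpha> c\<^sub>\<alpha> x\<^sup>\<alpha> - d x\<^sup>\<beta>\<close> splits into nonnegative circuit polynomials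
  that all share the inner exponent \<open>\<beta>\<close>.

  Substitute \<open>x = e\<^sup>y\<close>, with a sign change of one variable if \<open>d < 0\<close>, and divide by \<open>x\<^sup>\<beta>\<close>.
  Nonnegativity then says that \<open>g(y) = \<Sum>\<^sub>\<alpha> c\<^sub>\<alpha> exp((\<alpha> - \<beta>) \<bullet> y)\<close> is bounded below by \<open>\<bar>d\<bar>\<close>
  (\<open>nonneg_one_negative_term_exp_bound\<close>). Suppose \<open>g\<close> attains its minimum, at \<open>y\<close>. The vanishing
  of the gradient says that the weights \<open>\<nu>\<^sub>\<alpha> = c\<^sub>\<alpha> exp((\<alpha> - \<beta>) \<bullet> y)\<close> are balanced:
  \<open>\<Sum>\<^sub>\<alpha> \<nu>\<^sub>\<alpha> (\<alpha> - \<beta>) = 0\<close>, so \<open>\<beta>\<close> is their barycentre. If the minimum is not attained, there is a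
  direction of recession, along which some of the terms tend to \<open>0\<close> and the others are constant.
  The lower bound survives the loss of the former, which are monomial squares, so an induction
  reduces to the case of an attained minimum (\<open>exp_sum_balanced_face\<close>).

  Now fix \<open>y\<close> and let \<open>\<nu>\<close> vary over the balanced nonnegative weights. The polynomial
  \<open>\<Sum>\<^sub>\<alpha> \<nu>\<^sub>\<alpha> exp(-(\<alpha> - \<beta>) \<bullet> y) x\<^sup>\<alpha> - \<sigma> (\<Sum>\<^sub>\<alpha> \<nu>\<^sub>\<alpha>) x\<^sup>\<beta>\<close> is linear in \<open>\<nu>\<close>, and for \<open>\<bar>\<sigma>\<bar> \<le> 1\<close> it is
  always nonnegative, by the inequality of weighted arithmetic and geometric means
  (\<open>balanced_nonneg\<close>). It therefore suffices to write \<open>\<nu>\<close> as a sum of balanced weights with affinely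
  independent supports, since these give circuits. This is done as in the proof of
  Caratheodory's theorem: an affine dependence on the support can be added to and subtracted from
  \<open>\<nu>\<close> until a weight vanishes, and \<open>\<nu>\<close> is a convex combination of the two results
  (\<open>affine_dependent_split\<close>, \<open>balanced_in_SONC\<close>). Taking \<open>\<sigma> = d / \<Sum>\<^sub>\<alpha> \<nu>\<^sub>\<alpha>\<close> gives the theorem.
\<close>

section \<open>Minimising a sum of exponentials\<close>

text \<open>
  The sum depends only on the component of \<open>y\<close> in the span \<open>L\<close> of the vectors \<open>v i\<close>. On \<open>L\<close> it is
  coercive: it dominates the piecewise linear function \<open>h y = (\<Sum>i\<in>I. c i * max 0 (v i \<bullet> y))\<close>,
  which is positively homogeneous, and positive on \<open>L - {0}\<close> because a zero \<open>u\<close> of \<open>h\<close> satisfies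
  \<open>v i \<bullet> u \<le> 0\<close> for all \<open>i\<close>, hence with equality, so that \<open>u\<close> is orthogonal to \<open>L\<close>.
\<close>
lemma exp_sum_attains_min:
  fixes v :: "'i \<Rightarrow> 'e::euclidean_space" and c :: "'i \<Rightarrow> real"
  assumes fin: "finite I" and c: "\<And>i. i \<in> I \<Longrightarrow> c i > 0"
    and no_recession: "\<And>u. (\<And>i. i \<in> I \<Longrightarrow> v i \<bullet> u \<le> 0) \<Longrightarrow> (\<forall>i\<in>I. v i \<bullet> u = 0)"
  shows "\<exists>y. \<forall>z. (\<Sum>i\<in>I. c i * exp (v i \<bullet> y)) \<le> (\<Sum>i\<in>I. c i * exp (v i \<bullet> z))"
proof -
  define g where "g = (\<lambda>y. \<Sum>i\<in>I. c i * exp (v i \<bullet> y))"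
  define h where "h = (\<lambda>y. \<Sum>i\<in>I. c i * max 0 (v i \<bullet> y))"
  let ?L = "span (v ` I)"
  have cont_g: "continuous_on T g" and cont_h: "continuous_on T h" for T
    unfolding g_def h_def by (intro continuous_intros)+
  have h_le_g: "h y \<le> g y" for y
    unfolding g_def h_def
  proof (rule sum_mono)
    fix i assume "i \<in> I"
    have "max 0 (v i \<bullet> y) \<le> exp (v i \<bullet> y)"
      using exp_ge_add_one_self[of "v i \<bullet> y"] exp_gt_zero[of "v i \<bullet> y"] by linarith
    then show "c i * max 0 (v i \<bullet> y) \<le> c i * exp (v i \<bullet> y)"
      using c[OF \<open>i \<in> I\<close>] by simp
  qed
  have h_scale: "h (t *\<^sub>R u) = t * h u" if "t \<ge> 0" for t u
    unfolding h_def sum_distrib_left using that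
    by (intro sum.cong) (auto simp: max_def mult_le_0_iff zero_le_mult_iff)
  have h_pos: "h u > 0" if u: "u \<in> ?L" "u \<noteq> 0" for u
  proof -
    have nonneg: "\<forall>i\<in>I. 0 \<le> c i * max 0 (v i \<bullet> u)"
      using c by (simp add: less_imp_le)
    have "h u \<noteq> 0"
    proof
      assume "h u = 0"
      then have "\<forall>i\<in>I. c i * max 0 (v i \<bullet> u) = 0"
        unfolding h_def using nonneg fin by (subst (asm) sum_nonneg_eq_0_iff) auto
      then have "v i \<bullet> u \<le> 0" if "i \<in> I" for i
        using c[OF that] that by (auto simp: max_def split: if_splits)
      then have "\<forall>i\<in>I. v i \<bullet> u = 0"
        by (rule no_recession)
      then have "orthogonal u w" if "w \<in> v ` I" for w
        using that by (auto simp: orthogonal_def inner_commute)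
      then have "orthogonal u u"
        using u(1) orthogonal_to_span by blast
      then show False using u(2) by (simp add: orthogonal_self)
    qed
    moreover have "h u \<ge> 0"
      unfolding h_def using nonneg by (intro sum_nonneg) auto
    ultimately show ?thesis by linarith
  qed
  have "\<exists>\<delta>>0. \<forall>y\<in>?L. \<delta> * norm y \<le> h y"
  proof (cases "?L \<inter> sphere 0 1 = {}")
    case True
    have "y = 0" if "y \<in> ?L" for y
    proof (rule ccontr)
      assume "y \<noteq> 0"
      then have "y /\<^sub>R norm y \<in> ?L \<inter> sphere 0 1"
        using that by (auto intro: span_scale)
      then show False using True by blast
    qed
    then have "1 * norm y \<le> h y" if "y \<in> ?L" for y
      using that by (fastforce simp: h_def)
    then show ?thesis using zero_less_one by blast
  next
    case False
    have "compact (?L \<inter> sphere 0 1)"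
      by (simp add: closed_subspace closed_Int_compact)
    then obtain u where u: "u \<in> ?L \<inter> sphere 0 1" "\<And>w. w \<in> ?L \<inter> sphere 0 1 \<Longrightarrow> h u \<le> h w"
      using continuous_attains_inf[OF _ False cont_h] by blast
    have "h u * norm y \<le> h y" if "y \<in> ?L" for y
    proof (cases "y = 0")
      case True
      then show ?thesis by (simp add: h_def)
    next
      case False
      then have "h u \<le> h (y /\<^sub>R norm y)"
        using that by (intro u(2)) (auto intro: span_scale)
      also have "\<dots> = h y / norm y"
        using h_scale[of "inverse (norm y)" y] by (simp add: divide_inverse_commute)
      finally show ?thesis using False by (simp add: field_simps)
    qed
    moreover have "h u > 0" using u(1) by (intro h_pos) auto
    ultimately show ?thesis by blast
  qed
  then obtain \<delta> where \<delta>: "\<delta> > 0" "\<And>y. y \<in> ?L \<Longrightarrow> \<delta> * norm y \<le> h y" by blast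
  \<comment> \<open>Outside this ball, the lower bound \<open>\<delta> * norm y\<close> already exceeds the value at the origin.\<close>
  define K where "K = ?L \<inter> cball 0 (g 0 / \<delta>)"
  have "g 0 \<ge> 0" using h_le_g[of 0] by (simp add: h_def)
  then have "0 \<in> K" using \<delta>(1) by (auto simp: K_def span_zero)
  have "compact K" unfolding K_def by (simp add: closed_subspace closed_Int_compact)
  then obtain y where y: "y \<in> K" "\<forall>z\<in>K. g y \<le> g z"
    using continuous_attains_inf[OF _ _ cont_g] \<open>0 \<in> K\<close> by (metis empty_iff)
  have "g y \<le> g z" for z
  proof -
    obtain p q where pq: "p \<in> ?L" "\<forall>w\<in>?L. orthogonal q w" "z = p + q"
      by (rule orthogonal_subspace_decomp_exists[of "v ` I" z]) blast
    have "v i \<bullet> z = v i \<bullet> p" if "i \<in> I" for i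
      using bspec[OF pq(2), of "v i"] that pq(3)
      by (auto simp: inner_add_right orthogonal_def inner_commute span_base)
    then have "g z = g p" by (simp add: g_def)
    moreover have "g y \<le> g p"
    proof (cases "p \<in> K")
      case False
      then have "g 0 < \<delta> * norm p" using pq(1) \<delta>(1) by (auto simp: K_def field_simps)
      also have "\<dots> \<le> g p" using \<delta>(2)[OF pq(1)] h_le_g[of p] by linarith
      finally show ?thesis using y(2) \<open>0 \<in> K\<close> by force
    qed (use y(2) in blast)
    ultimately show ?thesis by simp
  qed
  then show ?thesis unfolding g_def by blast
qed

text \<open>
  The left-hand side is the gradient at the minimiser. It suffices to differentiate along the
  gradient itself.
\<close>
lemma exp_sum_min_balanced:
  fixes v :: "'i \<Rightarrow> 'e::euclidean_space" and c :: "'i \<Rightarrow> real"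
  assumes min: "\<And>z. (\<Sum>i\<in>I. c i * exp (v i \<bullet> y)) \<le> (\<Sum>i\<in>I. c i * exp (v i \<bullet> z))"
  shows "(\<Sum>i\<in>I. (c i * exp (v i \<bullet> y)) *\<^sub>R v i) = 0"
proof -
  define w where "w = (\<Sum>i\<in>I. (c i * exp (v i \<bullet> y)) *\<^sub>R v i)"
  let ?f = "\<lambda>t. \<Sum>i\<in>I. c i * exp (v i \<bullet> (y + t *\<^sub>R w))"
  have "(?f has_real_derivative (\<Sum>i\<in>I. c i * exp (v i \<bullet> y) * (v i \<bullet> w))) (at 0)"
    by (auto intro!: derivative_eq_intros sum.cong simp: inner_add_right)
  moreover have "\<forall>t. \<bar>0 - t\<bar> < 1 \<longrightarrow> ?f 0 \<le> ?f t" using min by simp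
  ultimately have "(\<Sum>i\<in>I. c i * exp (v i \<bullet> y) * (v i \<bullet> w)) = 0"
    using DERIV_local_min[of ?f _ 0 1] by simp
  moreover have "w \<bullet> w = (\<Sum>i\<in>I. c i * exp (v i \<bullet> y) * (v i \<bullet> w))"
    by (subst (1) w_def) (simp add: inner_sum_left)
  ultimately show ?thesis by (simp add: w_def)
qed

text \<open>
  Replace \<open>y\<close> by \<open>y + t *\<^sub>R u\<close> and let \<open>t\<close> tend to infinity: the terms with \<open>v i \<bullet> u < 0\<close> tend
  to \<open>0\<close> and those with \<open>v i \<bullet> u = 0\<close> do not change.
\<close>
lemma exp_sum_lower_bound_on_face:
  fixes v :: "'i \<Rightarrow> 'e::euclidean_space" and c :: "'i \<Rightarrow> real"
  assumes fin: "finite I" and bound: "\<And>y. d \<le> (\<Sum>i\<in>I. c i * exp (v i \<bullet> y))"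
    and u: "\<And>i. i \<in> I \<Longrightarrow> v i \<bullet> u \<le> 0"
  shows "d \<le> (\<Sum>i\<in>{i\<in>I. v i \<bullet> u = 0}. c i * exp (v i \<bullet> y))"
proof -
  let ?lim = "\<lambda>i. if v i \<bullet> u = 0 then c i * exp (v i \<bullet> y) else 0"
  have "((\<lambda>t. c i * exp (v i \<bullet> (y + t *\<^sub>R u))) \<longlongrightarrow> ?lim i) at_top" if "i \<in> I" for i
  proof (cases "v i \<bullet> u = 0")
    case True
    then show ?thesis by (simp add: inner_add_right)
  next
    case False
    then have neg: "v i \<bullet> u < 0" using u[OF that] by simp
    have "filterlim (\<lambda>t. v i \<bullet> y + t * (v i \<bullet> u)) at_bot at_top"
      using filterlim_tendsto_neg_mult_at_bot[OF tendsto_const neg filterlim_ident]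
      by (simp add: filterlim_tendsto_add_at_bot_iff[OF tendsto_const] mult.commute)
    then have "((\<lambda>t. exp (v i \<bullet> y + t * (v i \<bullet> u))) \<longlongrightarrow> 0) at_top"
      by (rule filterlim_compose[OF exp_at_bot])
    then have "((\<lambda>t. c i * exp (v i \<bullet> y + t * (v i \<bullet> u))) \<longlongrightarrow> c i * 0) at_top"
      by (intro tendsto_intros)
    then show ?thesis using False by (simp add: inner_add_right)
  qed
  then have "((\<lambda>t. \<Sum>i\<in>I. c i * exp (v i \<bullet> (y + t *\<^sub>R u))) \<longlongrightarrow> (\<Sum>i\<in>I. ?lim i)) at_top"
    by (intro tendsto_sum)
  then have "d \<le> (\<Sum>i\<in>I. ?lim i)"
    by (rule tendsto_lowerbound) (auto intro: bound always_eventually)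
  then show ?thesis
    by (simp add: sum.inter_filter[OF fin])
qed

text \<open>
  Either the minimum over all of \<open>I\<close> is attained, and the gradient vanishes there, or some direction
  \<open>u\<close> violates the recession condition of \<open>exp_sum_attains_min\<close>, and passing to the face
  \<open>v i \<bullet> u = 0\<close> removes at least one index while keeping the lower bound.
\<close>
lemma exp_sum_balanced_face:
  fixes v :: "'i \<Rightarrow> 'e::euclidean_space" and c :: "'i \<Rightarrow> real"
  assumes "finite I" and "\<And>i. i \<in> I \<Longrightarrow> c i > 0"
    and "\<And>y. d \<le> (\<Sum>i\<in>I. c i * exp (v i \<bullet> y))"
  obtains J y where "J \<subseteq> I" "(\<Sum>i\<in>J. (c i * exp (v i \<bullet> y)) *\<^sub>R v i) = 0"
    "d \<le> (\<Sum>i\<in>J. c i * exp (v i \<bullet> y))"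
proof -
  have "\<exists>J y. J \<subseteq> I \<and> (\<Sum>i\<in>J. (c i * exp (v i \<bullet> y)) *\<^sub>R v i) = 0 \<and>
    d \<le> (\<Sum>i\<in>J. c i * exp (v i \<bullet> y))"
    using assms
  proof (induction I rule: finite_psubset_induct)
    case (psubset I)
    show ?case
    proof (cases "\<exists>u. (\<forall>i\<in>I. v i \<bullet> u \<le> 0) \<and> \<not> (\<forall>i\<in>I. v i \<bullet> u = 0)")
      case True
      then obtain u where u: "\<And>i. i \<in> I \<Longrightarrow> v i \<bullet> u \<le> 0" "\<not> (\<forall>i\<in>I. v i \<bullet> u = 0)" by blast
      let ?I' = "{i\<in>I. v i \<bullet> u = 0}"
      have sub: "?I' \<subset> I" using u(2) by blast
      have "d \<le> (\<Sum>i\<in>?I'. c i * exp (v i \<bullet> y))" for y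
        using exp_sum_lower_bound_on_face[OF psubset.hyps psubset.prems(2) u(1)] by simp
      then have "\<exists>J y. J \<subseteq> ?I' \<and> (\<Sum>i\<in>J. (c i * exp (v i \<bullet> y)) *\<^sub>R v i) = 0 \<and>
          d \<le> (\<Sum>i\<in>J. c i * exp (v i \<bullet> y))"
        by (intro psubset.IH[OF sub]) (auto intro: psubset.prems(1))
      then show ?thesis using sub by blast
    next
      case False
      then have "\<exists>y. \<forall>z. (\<Sum>i\<in>I. c i * exp (v i \<bullet> y)) \<le> (\<Sum>i\<in>I. c i * exp (v i \<bullet> z))"
        by (intro exp_sum_attains_min[OF psubset.hyps psubset.prems(1)]) auto
      then obtain y where "\<forall>z. (\<Sum>i\<in>I. c i * exp (v i \<bullet> y)) \<le> (\<Sum>i\<in>I. c i * exp (v i \<bullet> z))"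
        by blast
      then show ?thesis
        using exp_sum_min_balanced[where I = I and c = c and v = v and y = y] psubset.prems(2)[of y]
        by (intro exI[of _ I] exI[of _ y]) simp
    qed
  qed
  then show thesis using that by blast
qed

section \<open>Monomials and evaluation\<close>

lemma eval_poly_superset:
  assumes "finite T" "Poly_Mapping.keys p \<subseteq> T"
  shows "eval_poly p x = (\<Sum>\<alpha>\<in>T. Poly_Mapping.lookup p \<alpha> * eval_monom \<alpha> x)"
  unfolding eval_poly_def using assms
  by (intro sum.mono_neutral_left) (auto simp: in_keys_iff)

lemma eval_poly_add: "eval_poly (p + q) x = eval_poly p x + eval_poly q x"
proof -
  let ?T = "Poly_Mapping.keys p \<union> Poly_Mapping.keys q"
  have T: "finite ?T" "Poly_Mapping.keys (p + q) \<subseteq> ?T" by (simp, rule keys_add)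
  show ?thesis
    using T eval_poly_superset[of ?T p x] eval_poly_superset[of ?T q x]
      eval_poly_superset[of ?T "p + q" x]
    by (simp add: lookup_add distrib_right sum.distrib)
qed

lemma eval_poly_single: "eval_poly (Poly_Mapping.single \<alpha> c) x = c * eval_monom \<alpha> x"
  by (subst eval_poly_superset[of "{\<alpha>}"]) auto

lemma eval_poly_diff: "eval_poly (p - q) x = eval_poly p x - eval_poly q x"
  using eval_poly_add[of "p - q" q x] by simp

lemma eval_poly_sum: "eval_poly (\<Sum>i\<in>I. p i) x = (\<Sum>i\<in>I. eval_poly (p i) x)"
proof (induction I rule: infinite_finite_induct)
  case (insert i I)
  then show ?case by (simp add: eval_poly_add)
qed (auto simp: eval_poly_def)

lemma eval_one_negative_term:
  "eval_poly ((\<Sum>\<alpha>\<in>A. Poly_Mapping.single \<alpha> (c \<alpha>)) - Poly_Mapping.single \<beta> d) x =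
    (\<Sum>\<alpha>\<in>A. c \<alpha> * eval_monom \<alpha> x) - d * eval_monom \<beta> x"
  by (simp add: eval_poly_diff eval_poly_sum eval_poly_single)

lemma eval_monom_even_nonneg: "\<alpha> \<in> even_exponents \<Longrightarrow> 0 \<le> eval_monom \<alpha> x"
  unfolding eval_monom_def even_exponents_def by (intro prod_nonneg) (auto intro: zero_le_even_power)

text \<open>
  The convention \<open>ln 0 = 0\<close> lets the identity cover vanishing coordinates too, as long as
  they do not occur in the monomial: they then contribute a factor \<open>1\<close> on both sides.
\<close>
lemma abs_eval_monom_exp:
  assumes "\<And>i. x $ i = 0 \<Longrightarrow> \<alpha> $ i = 0"
  shows "\<bar>eval_monom \<alpha> x\<bar> = exp (real_exponent \<alpha> \<bullet> (\<chi> i. ln \<bar>x $ i\<bar>))"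
proof -
  have "\<bar>x $ i\<bar> ^ (\<alpha> $ i) = exp (real (\<alpha> $ i) * ln \<bar>x $ i\<bar>)" for i
    using assms[of i] by (cases "x $ i = 0") (auto simp: exp_of_nat_mult)
  then show ?thesis
    by (simp add: eval_monom_def abs_prod power_abs inner_vec_def real_exponent_def exp_sum)
qed

lemma inj_real_exponent: "inj real_exponent"
  by (auto simp: inj_def real_exponent_def vec_eq_iff)

text \<open>
  Evaluate at \<open>x\<^sub>i = s\<^sub>i * exp y\<^sub>i\<close>, where the signs \<open>s\<^sub>i\<close> do not affect the even monomials and are
  chosen to turn \<open>d * x\<^sup>\<beta>\<close> into its absolute value. For negative \<open>d\<close> this takes the change of sign
  of one variable that has an odd exponent in \<open>\<beta>\<close>.
\<close>
lemma nonneg_one_negative_term_exp_bound: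
  fixes \<beta> :: "'n::finite exponent"
  assumes nonneg: "nonneg_poly ((\<Sum>\<alpha>\<in>A. Poly_Mapping.single \<alpha> (c \<alpha>)) - Poly_Mapping.single \<beta> d)"
    and A: "A \<subseteq> even_exponents" and \<beta>: "\<beta> \<notin> even_exponents \<or> d \<ge> 0"
  shows "\<bar>d\<bar> \<le> (\<Sum>\<alpha>\<in>A. c \<alpha> * exp ((real_exponent \<alpha> - real_exponent \<beta>) \<bullet> y))"
proof -
  obtain s :: "real ^ 'n" where s: "\<And>i. \<bar>s $ i\<bar> = 1" "d * eval_monom \<beta> s = \<bar>d\<bar>"
  proof (cases "d \<ge> 0")
    case True
    then show thesis by (intro that[of "\<chi> i. 1"]) (auto simp: eval_monom_def)
  next
    case False
    then obtain k where "odd (\<beta> $ k)" using \<beta> by (auto simp: even_exponents_def)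
    then have "eval_monom \<beta> (\<chi> i. if i = k then -1 else 1) = -1"
      unfolding eval_monom_def by (subst prod.remove[of _ k]) auto
    then show thesis using False by (intro that[of "\<chi> i. if i = k then -1 else 1"]) auto
  qed
  define x :: "real ^ 'n" where "x = (\<chi> i. s $ i * exp (y $ i))"
  have split: "eval_monom \<alpha> x = eval_monom \<alpha> s * exp (real_exponent \<alpha> \<bullet> y)" for \<alpha>
    by (simp add: x_def eval_monom_def power_mult_distrib prod.distrib exp_sum inner_vec_def
        real_exponent_def flip: exp_of_nat_mult)
  have even_s: "eval_monom \<alpha> s = 1" if "\<alpha> \<in> A" for \<alpha>
  proof -
    have "\<bar>eval_monom \<alpha> s\<bar> = 1" using s(1) by (simp add: eval_monom_def abs_prod power_abs)
    moreover have "eval_monom \<alpha> s \<ge> 0" using that A by (auto intro: eval_monom_even_nonneg)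
    ultimately show ?thesis by simp
  qed
  have "\<bar>d\<bar> * exp (real_exponent \<beta> \<bullet> y) = d * eval_monom \<beta> x"
    by (simp add: split flip: s(2))
  also have "\<dots> \<le> (\<Sum>\<alpha>\<in>A. c \<alpha> * eval_monom \<alpha> x)"
    using nonneg[unfolded nonneg_poly_def, rule_format, of x] by (simp add: eval_one_negative_term)
  also have "\<dots> = (\<Sum>\<alpha>\<in>A. c \<alpha> * exp (real_exponent \<alpha> \<bullet> y))"
    by (simp add: split even_s)
  also have "\<dots> = (\<Sum>\<alpha>\<in>A. c \<alpha> * exp ((real_exponent \<alpha> - real_exponent \<beta>) \<bullet> y)) * exp (real_exponent \<beta> \<bullet> y)"
    by (simp add: sum_distrib_right inner_diff_left exp_diff)
  finally show ?thesis by simp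
qed

section \<open>Balanced weights\<close>

text \<open>
  The weighted inequality of arithmetic and geometric means, obtained from \<open>exp t \<ge> 1 + t\<close>. Let \<open>x\<^sup>\<beta> \<noteq> 0\<close>, the other case being clear. At
  the point with \<open>\<bar>x\<^sub>i\<bar> = exp z\<^sub>i\<close>, division by \<open>\<bar>x\<^sup>\<beta>\<bar>\<close> leaves the sum of the
  \<open>\<nu>\<^sub>\<alpha> exp((\<alpha> - \<beta>) \<bullet> (z - y))\<close>. This is at least \<open>\<Sum>\<^sub>\<alpha> \<nu>\<^sub>\<alpha>\<close>, because the linear terms cancel by
  balance.
\<close>
lemma balanced_nonneg:
  fixes \<beta> :: "'n::finite exponent"
  assumes fin: "finite S" and pos: "\<And>\<alpha>. \<alpha> \<in> S \<Longrightarrow> \<nu> \<alpha> > 0" and S: "S \<subseteq> even_exponents"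
    and balanced: "(\<Sum>\<alpha>\<in>S. \<nu> \<alpha> *\<^sub>R (real_exponent \<alpha> - real_exponent \<beta>)) = 0" and \<sigma>: "\<bar>\<sigma>\<bar> \<le> 1"
  shows "nonneg_poly ((\<Sum>\<alpha>\<in>S. Poly_Mapping.single \<alpha>
        (\<nu> \<alpha> * exp (- ((real_exponent \<alpha> - real_exponent \<beta>) \<bullet> y))))
      - Poly_Mapping.single \<beta> (\<sigma> * (\<Sum>\<alpha>\<in>S. \<nu> \<alpha>)))"
proof -
  let ?v = "\<lambda>\<alpha>. real_exponent \<alpha> - real_exponent \<beta>"
  let ?w = "\<lambda>\<alpha>. \<nu> \<alpha> * exp (- (?v \<alpha> \<bullet> y))"
  have "\<sigma> * sum \<nu> S * eval_monom \<beta> x \<le> (\<Sum>\<alpha>\<in>S. ?w \<alpha> * eval_monom \<alpha> x)" for x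
  proof (cases "eval_monom \<beta> x = 0")
    case True
    have "0 \<le> (\<Sum>\<alpha>\<in>S. ?w \<alpha> * eval_monom \<alpha> x)"
      using S by (intro sum_nonneg mult_nonneg_nonneg eval_monom_even_nonneg) (auto simp: less_imp_le[OF pos])
    then show ?thesis by (simp add: True)
  next
    case False
    define z :: "real ^ 'n" where "z = (\<chi> i. ln \<bar>x $ i\<bar>)"
    have \<beta>0: "\<beta> $ i = 0" if "x $ i = 0" for i
      using False that by (auto simp: eval_monom_def)
    \<comment> \<open>As a barycentre with positive weights, \<open>\<beta>\<close> can have a zero coordinate only where all
      exponents in \<open>S\<close> do; so the vanishing coordinates of \<open>x\<close> occur in none of the monomials.\<close>
    have \<alpha>0: "\<alpha> $ i = 0" if "\<alpha> \<in> S" "x $ i = 0" for \<alpha> i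
    proof -
      have "(\<Sum>\<alpha>\<in>S. \<nu> \<alpha> * real (\<alpha> $ i)) = 0"
        using arg_cong[OF balanced, of "\<lambda>u. u $ i"] \<beta>0[OF that(2)]
        by (simp add: real_exponent_def)
      then have "\<nu> \<alpha> * real (\<alpha> $ i) = 0"
        using that(1) fin pos by (subst (asm) sum_nonneg_eq_0_iff) (auto simp: less_imp_le[OF pos])
      then show ?thesis using pos[OF that(1)] by simp
    qed
    have eval_\<alpha>: "eval_monom \<alpha> x = exp (real_exponent \<alpha> \<bullet> z)" if "\<alpha> \<in> S" for \<alpha>
      using abs_eval_monom_exp[of x \<alpha>] \<alpha>0[OF that] eval_monom_even_nonneg[of \<alpha> x] S that
      by (auto simp: z_def)
    have eval_\<beta>: "\<bar>eval_monom \<beta> x\<bar> = exp (real_exponent \<beta> \<bullet> z)"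
      unfolding z_def by (rule abs_eval_monom_exp[OF \<beta>0])
    have sum0: "(\<Sum>\<alpha>\<in>S. \<nu> \<alpha> * (?v \<alpha> \<bullet> (z - y))) = 0"
      using arg_cong[OF balanced, of "\<lambda>u. u \<bullet> (z - y)"] by (simp add: inner_sum_left)
    have "sum \<nu> S = (\<Sum>\<alpha>\<in>S. \<nu> \<alpha> * (1 + ?v \<alpha> \<bullet> (z - y)))"
      using sum0 by (simp add: distrib_left sum.distrib)
    also have "\<dots> \<le> (\<Sum>\<alpha>\<in>S. \<nu> \<alpha> * exp (?v \<alpha> \<bullet> (z - y)))"
      using pos by (intro sum_mono mult_left_mono) (auto intro: less_imp_le)
    finally have amgm: "sum \<nu> S \<le> (\<Sum>\<alpha>\<in>S. \<nu> \<alpha> * exp (?v \<alpha> \<bullet> (z - y)))" .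
    have nn: "sum \<nu> S \<ge> 0" by (intro sum_nonneg less_imp_le[OF pos])
    have "\<sigma> * sum \<nu> S * eval_monom \<beta> x \<le> \<bar>\<sigma> * sum \<nu> S * eval_monom \<beta> x\<bar>" by simp
    also have "\<dots> = \<bar>\<sigma>\<bar> * (sum \<nu> S * exp (real_exponent \<beta> \<bullet> z))"
      using nn by (simp add: abs_mult eval_\<beta>)
    also have "\<dots> \<le> sum \<nu> S * exp (real_exponent \<beta> \<bullet> z)"
      using \<sigma> nn by (intro mult_left_le_one_le) auto
    also have "\<dots> \<le> (\<Sum>\<alpha>\<in>S. \<nu> \<alpha> * exp (?v \<alpha> \<bullet> (z - y))) * exp (real_exponent \<beta> \<bullet> z)"
      using amgm by simp
    also have "\<dots> = (\<Sum>\<alpha>\<in>S. ?w \<alpha> * eval_monom \<alpha> x)"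
      unfolding sum_distrib_right
      by (intro sum.cong) (auto simp: eval_\<alpha> inner_diff_left inner_diff_right algebra_simps simp flip: exp_add)
    finally show ?thesis .
  qed
  then show ?thesis
    by (simp add: nonneg_poly_def eval_one_negative_term)
qed

lemma trellis_affine_independent:
  assumes "finite S" "S \<noteq> {}" "S \<subseteq> even_exponents" "\<not> affine_dependent (real_exponent ` S)"
  shows "trellis S"
proof -
  let ?R = "real_exponent ` S"
  have "(int (card ?R) - 1) simplex (convex hull ?R)"
    using assms by (auto simp: simplex_def)
  moreover have "?R = {v. v extreme_point_of (convex hull ?R)}"
    using extreme_point_of_convex_hull_affine_independent[OF assms(4)] by auto
  moreover have "0 \<le> int (card ?R) - 1"
  proof -
    have "card ?R > 0" using assms(1,2) by (simp add: card_gt_0_iff)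
    then show ?thesis by linarith
  qed
  ultimately show ?thesis using assms unfolding trellis_def by blast
qed

text \<open>
  Dividing the weights by their sum gives the barycentric coordinates of \<open>\<beta>\<close>, which are all
  positive.
\<close>
lemma balanced_in_rel_interior:
  fixes \<beta> :: "'n::finite exponent"
  assumes "finite S" "S \<noteq> {}" and pos: "\<And>\<alpha>. \<alpha> \<in> S \<Longrightarrow> \<nu> \<alpha> > 0"
    and indep: "\<not> affine_dependent (real_exponent ` S)"
    and balanced: "(\<Sum>\<alpha>\<in>S. \<nu> \<alpha> *\<^sub>R (real_exponent \<alpha> - real_exponent \<beta>)) = 0"
  shows "real_exponent \<beta> \<in> rel_interior (convex hull (real_exponent ` S))"
proof -
  define s where "s = sum \<nu> S"
  have s: "s > 0" unfolding s_def using assms(1-3) by (intro sum_pos)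
  define u where "u = (\<lambda>r. \<nu> (inv real_exponent r) / s)"
  have u: "u (real_exponent \<alpha>) = \<nu> \<alpha> / s" for \<alpha>
    by (simp add: u_def inv_f_f[OF inj_real_exponent])
  have inj: "inj_on real_exponent S" by (rule inj_on_subset[OF inj_real_exponent subset_UNIV])
  have "(\<Sum>\<alpha>\<in>S. \<nu> \<alpha> *\<^sub>R real_exponent \<alpha>) = s *\<^sub>R real_exponent \<beta>"
    using balanced by (simp add: scaleR_diff_right sum_subtractf scaleR_left.sum s_def)
  moreover have "(\<Sum>\<alpha>\<in>S. (\<nu> \<alpha> / s) *\<^sub>R real_exponent \<alpha>) =
      inverse s *\<^sub>R (\<Sum>\<alpha>\<in>S. \<nu> \<alpha> *\<^sub>R real_exponent \<alpha>)"
    by (simp add: scaleR_sum_right divide_inverse_commute)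
  ultimately have "(\<Sum>\<alpha>\<in>S. (\<nu> \<alpha> / s) *\<^sub>R real_exponent \<alpha>) = real_exponent \<beta>"
    using s by simp
  then have "(\<Sum>r\<in>real_exponent ` S. u r *\<^sub>R r) = real_exponent \<beta>"
    by (simp add: sum.reindex[OF inj] u)
  moreover have "sum u (real_exponent ` S) = 1"
    using s by (simp add: sum.reindex[OF inj] u s_def flip: sum_divide_distrib)
  moreover have "\<forall>r\<in>real_exponent ` S. u r > 0" using pos s by (auto simp: u)
  ultimately show ?thesis
    unfolding rel_interior_convex_hull_explicit[OF indep] by blast
qed

section \<open>Splitting balanced weights into circuits\<close>

lemma SONC_zero: "0 \<in> SONC"
  unfolding SONC_def by (auto intro: exI[of _ "[]"])

lemma SONC_add: "p \<in> SONC \<Longrightarrow> q \<in> SONC \<Longrightarrow> p + q \<in> SONC"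
proof -
  assume "p \<in> SONC" "q \<in> SONC"
  then obtain ps qs where "p = sum_list ps" "\<forall>p\<in>set ps. nonneg_circuit_poly p"
    "q = sum_list qs" "\<forall>p\<in>set qs. nonneg_circuit_poly p"
    unfolding SONC_def by auto
  then show ?thesis unfolding SONC_def by (auto intro!: exI[of _ "ps @ qs"])
qed

lemma SONC_sum: "(\<And>i. i \<in> I \<Longrightarrow> p i \<in> SONC) \<Longrightarrow> sum p I \<in> SONC"
  by (induction I rule: infinite_finite_induct) (auto intro: SONC_zero SONC_add)

lemma nonneg_circuit_poly_in_SONC: "nonneg_circuit_poly p \<Longrightarrow> p \<in> SONC"
  unfolding SONC_def by (auto intro!: exI[of _ "[p]"])

text \<open>
  The largest admissible step is the minimum of the ratios \<open>\<nu> b / \<mu> b\<close> over the coordinates that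
  decrease, as in the ratio test of the simplex method.
\<close>
lemma step_to_boundary:
  fixes \<nu> \<mu> :: "'a \<Rightarrow> real"
  assumes fin: "finite S" and pos: "\<And>a. a \<in> S \<Longrightarrow> \<nu> a > 0" and ex: "\<exists>a\<in>S. \<mu> a > 0"
  obtains s a where "s > 0" "\<forall>b\<in>S. 0 \<le> \<nu> b - s * \<mu> b" "a \<in> S" "\<nu> a - s * \<mu> a = 0"
proof -
  let ?T = "{a\<in>S. \<mu> a > 0}"
  have "finite ?T" "?T \<noteq> {}" using fin ex by auto
  then have "Min ((\<lambda>b. \<nu> b / \<mu> b) ` ?T) \<in> (\<lambda>b. \<nu> b / \<mu> b) ` ?T"
    by (intro Min_in) auto
  then obtain a where a: "a \<in> ?T" "\<nu> a / \<mu> a = Min ((\<lambda>b. \<nu> b / \<mu> b) ` ?T)"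
    by auto
  have a_le: "\<nu> a / \<mu> a \<le> \<nu> b / \<mu> b" if "b \<in> ?T" for b
    unfolding a(2) using that fin by (intro Min_le) auto
  show thesis
  proof (rule that[of "\<nu> a / \<mu> a" a])
    show s: "\<nu> a / \<mu> a > 0" using a(1) pos by simp
    show "\<forall>b\<in>S. 0 \<le> \<nu> b - \<nu> a / \<mu> a * \<mu> b"
    proof
      fix b assume b: "b \<in> S"
      show "0 \<le> \<nu> b - \<nu> a / \<mu> a * \<mu> b"
      proof (cases "\<mu> b > 0")
        case True
        then show ?thesis using a_le[of b] b by (simp add: pos_le_divide_eq)
      next
        case False
        then have "\<nu> a / \<mu> a * \<mu> b \<le> 0" using s by (intro mult_nonneg_nonpos) auto
        then show ?thesis using pos[OF b] by linarith
      qed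
    qed
  qed (use a(1) in auto)
qed

text \<open>
  The coefficients \<open>\<mu>\<close> of an affine dependence are themselves balanced and take both signs, so from
  \<open>\<nu>\<close> one can move along \<open>\<mu>\<close> in both directions until some weight vanishes. The two end points
  \<open>\<nu> - s \<mu>\<close> and \<open>\<nu> + t \<mu>\<close>, scaled by \<open>t / (s + t)\<close> and \<open>s / (s + t)\<close>, add up to \<open>\<nu>\<close>.
\<close>
lemma affine_dependent_split:
  fixes \<beta> :: "'n::finite exponent"
  assumes fin: "finite S" and pos: "\<And>\<alpha>. \<alpha> \<in> S \<Longrightarrow> \<nu> \<alpha> > 0"
    and balanced: "(\<Sum>\<alpha>\<in>S. \<nu> \<alpha> *\<^sub>R (real_exponent \<alpha> - real_exponent \<beta>)) = 0"
    and dep: "affine_dependent (real_exponent ` S)"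
  obtains \<nu>\<^sub>1 \<nu>\<^sub>2 where "\<forall>\<alpha>. \<nu> \<alpha> = \<nu>\<^sub>1 \<alpha> + \<nu>\<^sub>2 \<alpha>"
    "\<forall>\<kappa>\<in>{\<nu>\<^sub>1, \<nu>\<^sub>2}. (\<forall>\<alpha>\<in>S. \<kappa> \<alpha> \<ge> 0) \<and> (\<exists>\<alpha>\<in>S. \<kappa> \<alpha> = 0) \<and>
       (\<Sum>\<alpha>\<in>S. \<kappa> \<alpha> *\<^sub>R (real_exponent \<alpha> - real_exponent \<beta>)) = 0"
proof -
  have inj: "inj_on real_exponent S" by (rule inj_on_subset[OF inj_real_exponent subset_UNIV])
  obtain U where U: "sum U (real_exponent ` S) = 0" "\<exists>r\<in>real_exponent ` S. U r \<noteq> 0"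
    "(\<Sum>r\<in>real_exponent ` S. U r *\<^sub>R r) = 0"
    using dep fin by (auto simp: affine_dependent_explicit_finite)
  define \<mu> where "\<mu> = (\<lambda>\<alpha>. U (real_exponent \<alpha>))"
  have \<mu>: "sum \<mu> S = 0" "\<exists>\<alpha>\<in>S. \<mu> \<alpha> \<noteq> 0" "(\<Sum>\<alpha>\<in>S. \<mu> \<alpha> *\<^sub>R real_exponent \<alpha>) = 0"
    using U by (auto simp: \<mu>_def sum.reindex[OF inj])
  have \<mu>_bal: "(\<Sum>\<alpha>\<in>S. \<mu> \<alpha> *\<^sub>R (real_exponent \<alpha> - real_exponent \<beta>)) = 0"
    using \<mu> by (simp add: scaleR_diff_right sum_subtractf flip: scaleR_left.sum)
  have bal: "(\<Sum>\<alpha>\<in>S. (a * \<nu> \<alpha> + b * \<mu> \<alpha>) *\<^sub>R (real_exponent \<alpha> - real_exponent \<beta>)) = 0" for a b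
  proof -
    have "(\<Sum>\<alpha>\<in>S. (a * \<nu> \<alpha> + b * \<mu> \<alpha>) *\<^sub>R (real_exponent \<alpha> - real_exponent \<beta>)) =
      a *\<^sub>R (\<Sum>\<alpha>\<in>S. \<nu> \<alpha> *\<^sub>R (real_exponent \<alpha> - real_exponent \<beta>)) +
      b *\<^sub>R (\<Sum>\<alpha>\<in>S. \<mu> \<alpha> *\<^sub>R (real_exponent \<alpha> - real_exponent \<beta>))"
      by (simp add: scaleR_add_left sum.distrib scaleR_sum_right)
    then show ?thesis by (simp only: balanced \<mu>_bal scaleR_zero_right add_0)
  qed
  have up: "\<exists>\<alpha>\<in>S. \<mu> \<alpha> > 0"
  proof (rule ccontr)
    assume "\<not> ?thesis"
    then have "\<forall>\<alpha>\<in>S. \<mu> \<alpha> = 0"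
      using \<mu>(1) fin sum_nonneg_eq_0_iff[of S "\<lambda>\<alpha>. - \<mu> \<alpha>"] by (auto simp: sum_negf not_less)
    then show False using \<mu>(2) by blast
  qed
  have down: "\<exists>\<alpha>\<in>S. - \<mu> \<alpha> > 0"
  proof (rule ccontr)
    assume "\<not> ?thesis"
    then have "\<forall>\<alpha>\<in>S. \<mu> \<alpha> = 0"
      using \<mu>(1) fin sum_nonneg_eq_0_iff[of S \<mu>] by (auto simp: not_less)
    then show False using \<mu>(2) by blast
  qed
  obtain s a where s: "s > 0" "\<forall>\<alpha>\<in>S. 0 \<le> \<nu> \<alpha> - s * \<mu> \<alpha>" "a \<in> S" "\<nu> a - s * \<mu> a = 0"
    by (rule step_to_boundary[of S \<nu> \<mu>, OF fin pos up])
  obtain t b where t: "t > 0" "\<forall>\<alpha>\<in>S. 0 \<le> \<nu> \<alpha> - t * - \<mu> \<alpha>" "b \<in> S" "\<nu> b - t * - \<mu> b = 0"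
    by (rule step_to_boundary[of S \<nu> "\<lambda>\<alpha>. - \<mu> \<alpha>", OF fin pos down])
  let ?\<nu>1 = "\<lambda>\<alpha>. t / (s + t) * (\<nu> \<alpha> - s * \<mu> \<alpha>)" and ?\<nu>2 = "\<lambda>\<alpha>. s / (s + t) * (\<nu> \<alpha> + t * \<mu> \<alpha>)"
  show thesis
  proof (rule that[of ?\<nu>1 ?\<nu>2])
    show "\<forall>\<alpha>. \<nu> \<alpha> = ?\<nu>1 \<alpha> + ?\<nu>2 \<alpha>"
    proof
      fix \<alpha>
      have "(s + t) * (?\<nu>1 \<alpha> + ?\<nu>2 \<alpha>) = t * (\<nu> \<alpha> - s * \<mu> \<alpha>) + s * (\<nu> \<alpha> + t * \<mu> \<alpha>)"
        using s(1) t(1) by (simp add: distrib_left)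
      also have "\<dots> = (s + t) * \<nu> \<alpha>" by (simp add: algebra_simps)
      finally show "\<nu> \<alpha> = ?\<nu>1 \<alpha> + ?\<nu>2 \<alpha>" using s(1) t(1) by simp
    qed
  next
    show "\<forall>\<kappa>\<in>{?\<nu>1, ?\<nu>2}. (\<forall>\<alpha>\<in>S. \<kappa> \<alpha> \<ge> 0) \<and> (\<exists>\<alpha>\<in>S. \<kappa> \<alpha> = 0) \<and>
       (\<Sum>\<alpha>\<in>S. \<kappa> \<alpha> *\<^sub>R (real_exponent \<alpha> - real_exponent \<beta>)) = 0"
    proof
      fix \<kappa> assume "\<kappa> \<in> {?\<nu>1, ?\<nu>2}"
      then consider "\<kappa> = ?\<nu>1" | "\<kappa> = ?\<nu>2" by blast
      then show "(\<forall>\<alpha>\<in>S. \<kappa> \<alpha> \<ge> 0) \<and> (\<exists>\<alpha>\<in>S. \<kappa> \<alpha> = 0) \<and>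
         (\<Sum>\<alpha>\<in>S. \<kappa> \<alpha> *\<^sub>R (real_exponent \<alpha> - real_exponent \<beta>)) = 0"
      proof cases
        case 1
        have "\<kappa> = (\<lambda>\<alpha>. t / (s + t) * \<nu> \<alpha> + (- t / (s + t) * s) * \<mu> \<alpha>)"
          by (simp add: 1 algebra_simps)
        then have "(\<Sum>\<alpha>\<in>S. \<kappa> \<alpha> *\<^sub>R (real_exponent \<alpha> - real_exponent \<beta>)) = 0"
          by (simp only: bal)
        moreover have "\<forall>\<alpha>\<in>S. \<kappa> \<alpha> \<ge> 0" using s t(1) unfolding 1 by (intro ballI mult_nonneg_nonneg) auto
        moreover have "\<exists>\<alpha>\<in>S. \<kappa> \<alpha> = 0" using s(3,4) unfolding 1 by (intro bexI[of _ a]) auto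
        ultimately show ?thesis by blast
      next
        case 2
        have "\<kappa> = (\<lambda>\<alpha>. s / (s + t) * \<nu> \<alpha> + (s / (s + t) * t) * \<mu> \<alpha>)"
          by (simp add: 2 algebra_simps)
        then have "(\<Sum>\<alpha>\<in>S. \<kappa> \<alpha> *\<^sub>R (real_exponent \<alpha> - real_exponent \<beta>)) = 0"
          by (simp only: bal)
        moreover have "\<forall>\<alpha>\<in>S. \<kappa> \<alpha> \<ge> 0" using s(1) t unfolding 2 by (intro ballI mult_nonneg_nonneg) auto
        moreover have "\<exists>\<alpha>\<in>S. \<kappa> \<alpha> = 0" using t(3,4) unfolding 2 by (intro bexI[of _ b]) auto
        ultimately show ?thesis by blast
      qed
    qed
  qed
qed

text \<open>
  Induction on the support. The polynomial is linear in \<open>\<nu>\<close>, so as long as the support is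
  affinely dependent it is the sum of two polynomials of the same form with fewer terms. The point
  \<open>y\<close>, the factor \<open>\<sigma>\<close> and the exponent \<open>\<beta>\<close> stay fixed, which is why the pieces fit together.
\<close>
lemma balanced_in_SONC:
  fixes \<beta> :: "'n::finite exponent"
  assumes "finite S" and "\<And>\<alpha>. \<alpha> \<in> S \<Longrightarrow> \<nu> \<alpha> > 0" and "S \<subseteq> even_exponents"
    and "(\<Sum>\<alpha>\<in>S. \<nu> \<alpha> *\<^sub>R (real_exponent \<alpha> - real_exponent \<beta>)) = 0" and \<sigma>: "\<bar>\<sigma>\<bar> \<le> 1"
  shows "(\<Sum>\<alpha>\<in>S. Poly_Mapping.single \<alpha>
        (\<nu> \<alpha> * exp (- ((real_exponent \<alpha> - real_exponent \<beta>) \<bullet> y))))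
      - Poly_Mapping.single \<beta> (\<sigma> * (\<Sum>\<alpha>\<in>S. \<nu> \<alpha>)) \<in> SONC"
  using assms(1-4)
proof (induction S arbitrary: \<nu> rule: finite_psubset_induct)
  case (psubset S)
  let ?w = "\<lambda>\<alpha>. exp (- ((real_exponent \<alpha> - real_exponent \<beta>) \<bullet> y))"
  let ?P = "\<lambda>T \<nu>. (\<Sum>\<alpha>\<in>T. Poly_Mapping.single \<alpha> (\<nu> \<alpha> * ?w \<alpha>))
      - Poly_Mapping.single \<beta> (\<sigma> * sum \<nu> T)"
  consider "S = {}" | "S \<noteq> {}" "\<not> affine_dependent (real_exponent ` S)"
    | "affine_dependent (real_exponent ` S)" by blast
  then show ?case
  proof cases
    case 1
    then show ?thesis by (simp add: SONC_zero)
  next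
    case 2
    have "circuit_poly (?P S \<nu>)"
      unfolding circuit_poly_def
      using trellis_affine_independent[OF psubset.hyps 2(1) psubset.prems(2) 2(2)]
        balanced_in_rel_interior[OF psubset.hyps 2(1) psubset.prems(1) 2(2) psubset.prems(3)]
        psubset.prems(1)
      by (intro exI[of _ S] exI[of _ "\<lambda>\<alpha>. \<nu> \<alpha> * ?w \<alpha>"] exI[of _ "\<sigma> * sum \<nu> S"] exI[of _ \<beta>]) auto
    moreover have "nonneg_poly (?P S \<nu>)"
      by (rule balanced_nonneg[OF psubset.hyps psubset.prems \<sigma>])
    ultimately show ?thesis
      by (intro nonneg_circuit_poly_in_SONC) (simp add: nonneg_circuit_poly_def)
  next
    case 3
    obtain \<nu>\<^sub>1 \<nu>\<^sub>2 where split: "\<forall>\<alpha>. \<nu> \<alpha> = \<nu>\<^sub>1 \<alpha> + \<nu>\<^sub>2 \<alpha>"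
      and parts: "\<forall>\<kappa>\<in>{\<nu>\<^sub>1, \<nu>\<^sub>2}. (\<forall>\<alpha>\<in>S. \<kappa> \<alpha> \<ge> 0) \<and> (\<exists>\<alpha>\<in>S. \<kappa> \<alpha> = 0) \<and>
       (\<Sum>\<alpha>\<in>S. \<kappa> \<alpha> *\<^sub>R (real_exponent \<alpha> - real_exponent \<beta>)) = 0"
      by (rule affine_dependent_split[of S \<nu> \<beta>, OF psubset.hyps psubset.prems(1,3) 3])
    have "?P S \<kappa> \<in> SONC" if \<kappa>: "\<kappa> \<in> {\<nu>\<^sub>1, \<nu>\<^sub>2}" for \<kappa>
    proof -
      let ?T = "{\<alpha>\<in>S. \<kappa> \<alpha> > 0}"
      note \<kappa> = bspec[OF parts \<kappa>]
      have sub: "?T \<subset> S" using \<kappa> by force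
      have drop: "(\<Sum>\<alpha>\<in>S. f \<alpha>) = (\<Sum>\<alpha>\<in>?T. f \<alpha>)" if "\<And>\<alpha>. \<kappa> \<alpha> = 0 \<Longrightarrow> f \<alpha> = 0"
        for f :: "'n exponent \<Rightarrow> 'z::comm_monoid_add"
        using psubset.hyps \<kappa> that by (intro sum.mono_neutral_right) (auto simp: less_le)
      have "?P ?T \<kappa> \<in> SONC"
        using sub psubset.prems(2) \<kappa>
        by (intro psubset.IH) (auto simp: drop[symmetric])
      then show ?thesis by (simp add: drop)
    qed
    then have "?P S \<nu>\<^sub>1 + ?P S \<nu>\<^sub>2 \<in> SONC" by (intro SONC_add) auto
    also have "?P S \<nu>\<^sub>1 + ?P S \<nu>\<^sub>2 = ?P S \<nu>"
      by (simp add: split[rule_format] distrib_left distrib_right single_add sum.distrib algebra_simps)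
    finally show ?thesis .
  qed
qed

section \<open>The two inclusions\<close>

text \<open>
  The terms off the face on which the weights are balanced are monomial squares. On the face,
  \<open>\<nu>\<close> has total weight at least \<open>\<bar>d\<bar>\<close>, so the coefficient \<open>d\<close> is \<open>\<sigma>\<close> times the total weight for
  some \<open>\<sigma>\<close> of absolute value at most \<open>1\<close>.
\<close>
lemma AGE_poly_in_SONC:
  fixes p :: "'n::finite mpolynomial"
  assumes "AGE_poly p"
  shows "p \<in> SONC"
proof -
  obtain m :: nat and c \<alpha> d \<beta> where nonneg: "nonneg_poly p"
    and c: "\<And>i. i \<in> {1..m} \<Longrightarrow> \<alpha> i \<in> even_exponents \<and> c i > 0"
    and \<beta>: "\<beta> \<notin> even_exponents \<or> d \<ge> 0"
    and p: "p = (\<Sum>i=1..m. Poly_Mapping.single (\<alpha> i) (c i)) - Poly_Mapping.single \<beta> d"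
    using assms unfolding AGE_poly_def by blast
  \<comment> \<open>The exponents of an AGE polynomial may repeat; affine independence is about the set of
    exponents, so equal ones are collected first.\<close>
  define A where "A = \<alpha> ` {1..m}"
  define C where "C = (\<lambda>a. \<Sum>i\<in>{i\<in>{1..m}. \<alpha> i = a}. c i)"
  have A: "finite A" "A \<subseteq> even_exponents" using c by (auto simp: A_def)
  have C: "C a > 0" if "a \<in> A" for a
    unfolding C_def using that c by (intro sum_pos) (auto simp: A_def)
  have single_sum: "Poly_Mapping.single a (\<Sum>i\<in>I. f i) = (\<Sum>i\<in>I. Poly_Mapping.single a (f i))"
    for a :: "'n exponent" and f :: "nat \<Rightarrow> real" and I
    by (induction I rule: infinite_finite_induct) (auto simp: single_add)
  have "(\<Sum>i=1..m. Poly_Mapping.single (\<alpha> i) (c i)) =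
      (\<Sum>a\<in>A. \<Sum>i\<in>{i\<in>{1..m}. \<alpha> i = a}. Poly_Mapping.single (\<alpha> i) (c i))"
    unfolding A_def by (rule sum.image_gen) simp
  also have "\<dots> = (\<Sum>a\<in>A. Poly_Mapping.single a (C a))"
    unfolding C_def single_sum by (intro sum.cong) auto
  finally have p: "p = (\<Sum>a\<in>A. Poly_Mapping.single a (C a)) - Poly_Mapping.single \<beta> d"
    using p by simp
  let ?v = "\<lambda>a. real_exponent a - real_exponent \<beta>"
  have bound: "\<bar>d\<bar> \<le> (\<Sum>a\<in>A. C a * exp (?v a \<bullet> y))" for y
    by (rule nonneg_one_negative_term_exp_bound[OF nonneg[unfolded p] A(2) \<beta>])
  obtain J y where J: "J \<subseteq> A" "(\<Sum>a\<in>J. (C a * exp (?v a \<bullet> y)) *\<^sub>R ?v a) = 0"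
    "\<bar>d\<bar> \<le> (\<Sum>a\<in>J. C a * exp (?v a \<bullet> y))"
    by (rule exp_sum_balanced_face[of A C "\<bar>d\<bar>" ?v, OF A(1) C bound])
  define \<nu> where "\<nu> = (\<lambda>a. C a * exp (?v a \<bullet> y))"
  \<comment> \<open>If the total weight is \<open>0\<close>, so is \<open>d\<close>, and the value \<open>d / 0 = 0\<close> is the right one.\<close>
  define \<sigma> where "\<sigma> = d / sum \<nu> J"
  have "\<bar>d\<bar> \<le> sum \<nu> J" using J(3) by (simp add: \<nu>_def)
  then have \<sigma>: "\<bar>\<sigma>\<bar> \<le> 1" "\<sigma> * sum \<nu> J = d"
    by (auto simp: \<sigma>_def abs_divide divide_le_eq_1)
  have "(\<Sum>a\<in>J. Poly_Mapping.single a (\<nu> a * exp (- (?v a \<bullet> y))))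
      - Poly_Mapping.single \<beta> (\<sigma> * (\<Sum>a\<in>J. \<nu> a)) \<in> SONC"
    using J A C \<sigma>(1) by (intro balanced_in_SONC) (auto simp: \<nu>_def intro: finite_subset)
  then have "(\<Sum>a\<in>J. Poly_Mapping.single a (C a)) - Poly_Mapping.single \<beta> d \<in> SONC"
    unfolding \<sigma>(2) by (simp add: \<nu>_def mult.assoc flip: exp_add)
  moreover have "(\<Sum>a\<in>A - J. Poly_Mapping.single a (C a)) \<in> SONC"
    using A C by (intro SONC_sum nonneg_circuit_poly_in_SONC)
      (auto simp: nonneg_circuit_poly_def monomial_square_def)
  ultimately have "(\<Sum>a\<in>A - J. Poly_Mapping.single a (C a)) +
      ((\<Sum>a\<in>J. Poly_Mapping.single a (C a)) - Poly_Mapping.single \<beta> d) \<in> SONC"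
    by (intro SONC_add)
  then show ?thesis
    unfolding p sum.subset_diff[OF J(1) A(1)] by (simp add: add_diff_eq)
qed

lemma AGE_polyI:
  assumes "nonneg_poly ((\<Sum>\<alpha>\<in>A. Poly_Mapping.single \<alpha> (c \<alpha>)) - Poly_Mapping.single \<beta> d)"
    and "finite A" "A \<subseteq> even_exponents" "\<And>\<alpha>. \<alpha> \<in> A \<Longrightarrow> c \<alpha> > 0" "\<beta> \<notin> even_exponents \<or> d \<ge> 0"
  shows "AGE_poly ((\<Sum>\<alpha>\<in>A. Poly_Mapping.single \<alpha> (c \<alpha>)) - Poly_Mapping.single \<beta> d)"
proof -
  obtain h where h: "bij_betw h {1..card A} A"
    using ex_bij_betw_nat_finite_1[OF assms(2)] by blast
  have "(\<Sum>\<alpha>\<in>A. Poly_Mapping.single \<alpha> (c \<alpha>)) = (\<Sum>i=1..card A. Poly_Mapping.single (h i) (c (h i)))"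
    using sum.reindex_bij_betw[OF h, of "\<lambda>\<alpha>. Poly_Mapping.single \<alpha> (c \<alpha>)"] by simp
  moreover have "\<forall>i\<in>{1..card A}. h i \<in> even_exponents \<and> c (h i) > 0"
    using assms(3,4) bij_betwE[OF h] by blast
  ultimately show ?thesis
    unfolding AGE_poly_def using assms(1,5)
    by (intro conjI exI[of _ "card A"] exI[of _ "\<lambda>i. c (h i)"] exI[of _ h] exI[of _ d] exI[of _ \<beta>]) auto
qed

lemma AGE_poly_monomial:
  assumes "\<alpha> \<in> even_exponents" "c > 0"
  shows "AGE_poly (Poly_Mapping.single \<alpha> c)"
proof -
  have "nonneg_poly (Poly_Mapping.single \<alpha> c)"
    using assms by (simp add: nonneg_poly_def eval_poly_single eval_monom_even_nonneg)
  then show ?thesis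
    using AGE_polyI[of "\<lambda>_. c" "{\<alpha>}" \<alpha> 0] assms by simp
qed

lemma SAGE_add: "p \<in> SAGE \<Longrightarrow> q \<in> SAGE \<Longrightarrow> p + q \<in> SAGE"
proof -
  assume "p \<in> SAGE" "q \<in> SAGE"
  then obtain ps qs where "p = sum_list ps" "\<forall>p\<in>set ps. AGE_poly p"
    "q = sum_list qs" "\<forall>p\<in>set qs. AGE_poly p"
    unfolding SAGE_def by auto
  then show ?thesis unfolding SAGE_def by (auto intro!: exI[of _ "ps @ qs"])
qed

lemma SAGE_zero: "0 \<in> SAGE"
  unfolding SAGE_def by (auto intro: exI[of _ "[]"])

lemma SAGE_sum: "(\<And>i. i \<in> I \<Longrightarrow> p i \<in> SAGE) \<Longrightarrow> sum p I \<in> SAGE"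
  by (induction I rule: infinite_finite_induct) (auto intro: SAGE_zero SAGE_add)

lemma AGE_poly_in_SAGE: "AGE_poly p \<Longrightarrow> p \<in> SAGE"
  unfolding SAGE_def by (auto intro!: exI[of _ "[p]"])

text \<open>
  The only circuit polynomials not of AGE form have a positive inner term with an even exponent;
  all their terms are then monomial squares.
\<close>
lemma nonneg_circuit_poly_in_SAGE:
  fixes p :: "'n::finite mpolynomial"
  assumes "nonneg_circuit_poly p"
  shows "p \<in> SAGE"
  using assms unfolding nonneg_circuit_poly_def
proof
  assume "monomial_square p"
  then show ?thesis
    by (auto simp: monomial_square_def intro: AGE_poly_in_SAGE AGE_poly_monomial)
next
  assume circ: "circuit_poly p \<and> nonneg_poly p"
  then obtain A c d \<beta> where A: "trellis A" "\<And>\<alpha>. \<alpha> \<in> A \<Longrightarrow> c \<alpha> > 0"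
    and p: "p = (\<Sum>\<alpha>\<in>A. Poly_Mapping.single \<alpha> (c \<alpha>)) - Poly_Mapping.single \<beta> d"
    unfolding circuit_poly_def by blast
  have fin: "finite A" "A \<subseteq> even_exponents" using A(1) by (auto simp: trellis_def)
  show ?thesis
  proof (cases "\<beta> \<notin> even_exponents \<or> d \<ge> 0")
    case True
    then show ?thesis
      using AGE_polyI[of c A \<beta> d] circ fin A(2) by (auto simp: p intro: AGE_poly_in_SAGE)
  next
    case False
    have "(\<Sum>\<alpha>\<in>A. Poly_Mapping.single \<alpha> (c \<alpha>)) + Poly_Mapping.single \<beta> (- d) \<in> SAGE"
      using False fin A(2) by (intro SAGE_add SAGE_sum AGE_poly_in_SAGE AGE_poly_monomial) auto
    then show ?thesis by (simp add: p single_uminus)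
  qed
qed

theorem corollary3p14:
  "(SONC :: 'n::finite mpolynomial set) = SAGE"
proof
  have "sum_list ps \<in> SAGE" if "\<forall>p\<in>set ps. nonneg_circuit_poly p" for ps :: "'n mpolynomial list"
    using that by (induction ps) (auto intro: SAGE_zero SAGE_add nonneg_circuit_poly_in_SAGE)
  then show "(SONC :: 'n mpolynomial set) \<subseteq> SAGE" unfolding SONC_def by blast
  have "sum_list ps \<in> SONC" if "\<forall>p\<in>set ps. AGE_poly p" for ps :: "'n mpolynomial list"
    using that by (induction ps) (auto intro: SONC_zero SONC_add AGE_poly_in_SONC)
  then show "(SAGE :: 'n mpolynomial set) \<subseteq> SONC" unfolding SAGE_def by blast
qed

end
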